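(* All Steiner-Soddy polygons $P$ of the family are inscribed in one fixed conic $E$, which is (i) an ellipse if the inversion center $Q$ is interior to $S_{reg}$ or exterior to $S'_{reg}$; (ii) a hyperbola if $Q$ lies in the (open) annulus between $S_{reg}$ and $S'_{reg}$; (iii) a parabola if $Q$ lies on either of the circles $S_{reg}$, $S'_{reg}$. Furthermore, the foci of $E$ are the centers of the two Soddy circles $S$ and $S'$. In the parabola case, one of the two Soddy circles (call it $S'$) has its center at infinity, that is, it becomes a line, and this line is parallel to the directrix of $E$ (the finite focus of $E$ being the center of the other Soddy circle).
   Context: Setting. Let $N\ge 3$, $R>0$, $\alpha=\pi/N$. For $\varphi\in\mathbb{R}$ consider the $N$ circles of radius $R\sin\alpha$ centered at the vertices $R(\cos(\varphi+2\pi i/N),\sin(\varphi+2\pi i/N))$, $i=1,\dots,N$ (indices mod $N$), of a regular $N$-gon. Consecutive circles are tangent; all are tangent to the two circles $S_{reg}$ and $S'_{reg}$ centered at the origin with radii $R(1-\sin\alpha)$ and $R(1+\sin\alpha)$; the points of contact of consecutive circles lie on the circle $C_{reg}$ centered at the origin with radius $R\cos\alpha$. Fix an inversion circle with center $Q$ and radius $\lambda>0$, where $Q\notin C_{reg}$. The images under this inversion of the $N$ circles form a Steiner chain; letting $\varphi$ vary (with $R,Q,\lambda$ fixed) gives the Steiner porism. Values of $\varphi$ for which $Q$ lies on one of the $N$ circles are excluded, so all circles of the chain are genuine circles. The images $S,S'$ of $S_{reg},S'_{reg}$ (each a circle, or a line if it passes through $Q$) are the inner and outer Soddy circles of the chain;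 they do not depend on $\varphi$. The Steiner-Soddy polygon $P$ (for given $\varphi$) is the $N$-gon whose consecutive vertices $P_1,\dots,P_N$ are the centers of the consecutive circles in the Steiner chain. A circle counts as an ellipse with coinciding foci. *)

theory Defs
  imports "HOL-Analysis.Analysis"
begin

text \<open>The Euclidean plane is modelled by the type \<^typ>\<open>complex\<close>.\<close>

definition is_circle :: "complex set \<Rightarrow> bool" where
  "is_circle A \<longleftrightarrow> (\<exists>c r. r > 0 \<and> A = sphere c r)"

definition circle_center :: "complex set \<Rightarrow> complex" where
  "circle_center A = (THE c. \<exists>r>0. A = sphere c r)"

definition is_line :: "complex set \<Rightarrow> bool" where
  "is_line L \<longleftrightarrow> (\<exists>a b. a \<noteq> b \<and> L = affine hull {a, b})"

definition parallel_lines :: "complex set \<Rightarrow> complex set \<Rightarrow> bool" where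
  "parallel_lines L M \<longleftrightarrow> is_line L \<and> is_line M \<and> L \<inter> M = {}"

text \<open>Nondegenerate conics. The two foci of an ellipse may coincide, in which case it is a
  circle; a hyperbola consists of both its branches.\<close>

definition is_ellipse :: "complex \<Rightarrow> complex \<Rightarrow> complex set \<Rightarrow> bool" where
  "is_ellipse F F' E \<longleftrightarrow>
     (\<exists>a. dist F F' < 2 * a \<and> E = {z. dist z F + dist z F' = 2 * a})"

definition is_hyperbola :: "complex \<Rightarrow> complex \<Rightarrow> complex set \<Rightarrow> bool" where
  "is_hyperbola F F' E \<longleftrightarrow>
     (\<exists>a>0. 2 * a < dist F F' \<and> E = {z. \<bar>dist z F - dist z F'\<bar> = 2 * a})"

definition is_parabola :: "complex \<Rightarrow> complex set \<Rightarrow> complex set \<Rightarrow> bool" where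
  "is_parabola F L E \<longleftrightarrow> is_line L \<and> F \<notin> L \<and> E = {z. dist z F = infdist z L}"

definition inversion :: "complex \<Rightarrow> real \<Rightarrow> complex \<Rightarrow> complex" where
  "inversion Q lam z = Q + (lam\<^sup>2 / (dist z Q)\<^sup>2) *\<^sub>R (z - Q)"

text \<open>The inversion is undefined at its center. With the center removed, the image of a circle
  through it is exactly a line, and the image of any other circle is a circle.\<close>

definition inversion_image :: "complex \<Rightarrow> real \<Rightarrow> complex set \<Rightarrow> complex set" where
  "inversion_image Q lam A = inversion Q lam ` (A - {Q})"

definition reg_circle :: "nat \<Rightarrow> real \<Rightarrow> real \<Rightarrow> nat \<Rightarrow> complex set" where
  "reg_circle N R \<phi> i = sphere (rcis R (\<phi> + 2 * pi * real i / real N)) (R * sin (pi / real N))"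

definition inner_radius :: "nat \<Rightarrow> real \<Rightarrow> real" where
  "inner_radius N R = R * (1 - sin (pi / real N))"

definition outer_radius :: "nat \<Rightarrow> real \<Rightarrow> real" where
  "outer_radius N R = R * (1 + sin (pi / real N))"

definition S_reg :: "nat \<Rightarrow> real \<Rightarrow> complex set" where
  "S_reg N R = sphere 0 (inner_radius N R)"

definition S_reg' :: "nat \<Rightarrow> real \<Rightarrow> complex set" where
  "S_reg' N R = sphere 0 (outer_radius N R)"

definition C_reg :: "nat \<Rightarrow> real \<Rightarrow> complex set" where
  "C_reg N R = sphere 0 (R * cos (pi / real N))"

definition steiner_circle :: "nat \<Rightarrow> real \<Rightarrow> complex \<Rightarrow> real \<Rightarrow> real \<Rightarrow> nat \<Rightarrow> complex set" where
  "steiner_circle N R Q lam \<phi> i = inversion_image Q lam (reg_circle N R \<phi> i)"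

definition admissible :: "nat \<Rightarrow> real \<Rightarrow> complex \<Rightarrow> real \<Rightarrow> bool" where
  "admissible N R Q \<phi> \<longleftrightarrow> (\<forall>i\<in>{1..N}. Q \<notin> reg_circle N R \<phi> i)"

text \<open>A polygon is given by the list of its consecutive vertices.\<close>

definition steiner_soddy_polygon ::
    "nat \<Rightarrow> real \<Rightarrow> complex \<Rightarrow> real \<Rightarrow> real \<Rightarrow> complex list" where
  "steiner_soddy_polygon N R Q lam \<phi> =
     map (\<lambda>i. circle_center (steiner_circle N R Q lam \<phi> i)) [1..<N + 1]"

definition inscribed_in :: "complex list \<Rightarrow> complex set \<Rightarrow> bool" where
  "inscribed_in P E \<longleftrightarrow> set P \<subseteq> E"

definition soddy :: "nat \<Rightarrow> real \<Rightarrow> complex \<Rightarrow> real \<Rightarrow> complex set" where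
  "soddy N R Q lam = inversion_image Q lam (S_reg N R)"

definition soddy' :: "nat \<Rightarrow> real \<Rightarrow> complex \<Rightarrow> real \<Rightarrow> complex set" where
  "soddy' N R Q lam = inversion_image Q lam (S_reg' N R)"

lemma sphere_center_unique:
  fixes c c' :: complex
  assumes "r > 0" and eq: "sphere c r = sphere c' r'"
  shows "c = c'"
proof (rule ccontr)
  assume ne: "c \<noteq> c'"
  define d where "d = cmod (c' - c)"
  define w where "w = (1 / d) *\<^sub>R (c' - c)"
  have d: "d > 0" using ne by (simp add: d_def)
  have w: "cmod w = 1" using d by (simp add: w_def d_def)
  have c': "c' = c + d *\<^sub>R w" using d by (simp add: w_def)
  have "c + r *\<^sub>R w \<in> sphere c r" "c - r *\<^sub>R w \<in> sphere c r"
    using assms(1) w by (simp_all add: dist_norm)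
  then have "cmod ((d - r) *\<^sub>R w) = r'" "cmod ((d + r) *\<^sub>R w) = r'"
    unfolding eq c' by (simp_all add: dist_norm algebra_simps)
  then have "\<bar>d - r\<bar> = \<bar>d + r\<bar>" unfolding norm_scaleR w by simp
  then show False using d assms(1) by linarith
qed

lemma circle_center_sphere:
  assumes "r > 0"
  shows "circle_center (sphere c r) = c"
  unfolding circle_center_def
  using assms sphere_center_unique by (intro the_equality) (blast, metis)

end

theory Submission
  imports Defs
begin

text \<open>
  Give every circle a signed radius, and call circles with centers \<open>c\<close>, \<open>c'\<close> and signed radii
  \<open>r\<close>, \<open>r'\<close> tangent if \<open>dist c c' = \<bar>r + r'\<bar>\<close>. Equal signs mean external and opposite signs mean
  internal tangency. If \<open>p = dist c Q ^ 2 - r ^ 2\<close> is the power of \<open>Q\<close>, the inverted circle has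
  center \<open>Q + (lam ^ 2 / p) *\<^sub>R (c - Q)\<close>, and with \<open>lam ^ 2 * r / p\<close> as its signed radius tangency
  survives the inversion (\<open>dist_inv_center_tangent\<close>), however \<open>Q\<close> lies relative to the circles.

  Let \<open>s = R * sin (pi / N)\<close>, and orient the two regular Soddy circles by the signed radii
  \<open>a = R - s\<close> and \<open>- b = - (R + s)\<close>. Every circle of the regular chain has signed radius \<open>s\<close>
  and is tangent to both. After inversion a chain circle has a signed radius \<open>\<rho>\<close>, the two Soddy
  circles have signed radii \<open>\<sigma>\<close> and \<open>\<sigma>'\<close>, and the distances of the chain center from the two
  Soddy centers are \<open>\<bar>\<rho> + \<sigma>\<bar>\<close> and \<open>\<bar>\<rho> + \<sigma>'\<bar>\<close>. The difference of \<open>\<rho> + \<sigma>\<close> and \<open>\<rho> + \<sigma>'\<close> is the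
  constant \<open>\<sigma> - \<sigma>'\<close>. So the sum of the two distances is \<open>\<bar>\<sigma> - \<sigma>'\<bar>\<close> when these numbers have
  opposite signs, and the absolute difference of the distances is \<open>\<bar>\<sigma> - \<sigma>'\<bar>\<close> when they have equal
  signs. If \<open>D\<close>, \<open>p\<close>, \<open>p'\<close> are the powers of \<open>Q\<close> with respect to the chain circle and the inner and
  the outer Soddy circle before inversion, then \<open>\<rho> + \<sigma> = lam ^ 2 * (s + a) * q / (D * p)\<close> and
  \<open>\<rho> + \<sigma>' = lam ^ 2 * (s - b) * q' / (D * p')\<close>, where \<open>q\<close> and \<open>q'\<close> are the squared distances of \<open>Q\<close>
  from the two points of tangency (\<open>circle_power_tangent\<close>). Since \<open>s + a = R\<close> and \<open>s - b = - R\<close>,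
  the sign of the product of these numbers is opposite to that of \<open>p * p'\<close>
  (\<open>inv_radius_sum_sign\<close>), and \<open>p * p'\<close> is negative exactly in the open annulus. The same product
  decides how \<open>\<bar>\<sigma> - \<sigma>'\<bar>\<close> compares with the distance of the foci
  (\<open>inv_radius_diff_sq_concentric\<close>). The number \<open>\<sigma> - \<sigma>'\<close> vanishes exactly when
  \<open>(norm Q) ^ 2 = a * b = (R * cos (pi / N)) ^ 2\<close>, that is, on the circle of the contact points.

  If \<open>Q\<close> lies on one regular Soddy circle, that circle becomes a line at distance \<open>\<bar>\<rho>\<bar>\<close> from the
  chain center. If \<open>\<tau>\<close> is the signed radius of the image of the other one, the center of this image
  is at distance \<open>\<bar>\<rho> + \<tau>\<bar>\<close>. Moving the line by the signed distance \<open>\<tau>\<close> along its normal, suitably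
  oriented, makes the two distances equal, so the translated line is the directrix
  (\<open>parabola_of_centers\<close>).
\<close>

section \<open>Inversion of circles with signed radii\<close>

definition circle_power :: "complex \<Rightarrow> complex \<Rightarrow> real \<Rightarrow> real" where
  "circle_power Q c r = (dist c Q)\<^sup>2 - r\<^sup>2"

definition inv_center :: "complex \<Rightarrow> real \<Rightarrow> complex \<Rightarrow> real \<Rightarrow> complex" where
  "inv_center Q lam c r = Q + (lam\<^sup>2 / circle_power Q c r) *\<^sub>R (c - Q)"

text \<open>The sign comes from \<open>r\<close> and from the power of the inversion center. It is kept because it
  makes tangency of the image circles a single equation in all configurations.\<close>

definition inv_radius :: "complex \<Rightarrow> real \<Rightarrow> complex \<Rightarrow> real \<Rightarrow> real" where
  "inv_radius Q lam c r = lam\<^sup>2 * r / circle_power Q c r"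

lemma inversion_neq_center:
  assumes "lam > 0" "z \<noteq> Q"
  shows "inversion Q lam z \<noteq> Q"
  using assms by (simp add: inversion_def)

lemma inversion_involutive:
  assumes "lam > 0" "z \<noteq> Q"
  shows "inversion Q lam (inversion Q lam z) = z"
proof -
  have d: "dist (inversion Q lam z) Q = lam\<^sup>2 / dist z Q"
    using assms by (simp add: inversion_def dist_norm power2_eq_square)
  have "inversion Q lam (inversion Q lam z)
      = Q + ((lam\<^sup>2 / (lam\<^sup>2 / dist z Q)\<^sup>2) * (lam\<^sup>2 / (dist z Q)\<^sup>2)) *\<^sub>R (z - Q)"
    by (subst inversion_def) (simp only: d, simp add: inversion_def)
  also have "(lam\<^sup>2 / (lam\<^sup>2 / dist z Q)\<^sup>2) * (lam\<^sup>2 / (dist z Q)\<^sup>2) = 1"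
    using assms by (simp add: field_simps power2_eq_square)
  finally show ?thesis by simp
qed

text \<open>The inversion is an involution of the punctured plane, so the image of a set is its preimage.
  This turns the computation of an image into a pointwise equivalence of equations.\<close>

lemma inversion_image_eqI:
  assumes "lam > 0" "Q \<notin> B" "\<And>z. z \<noteq> Q \<Longrightarrow> inversion Q lam z \<in> B \<longleftrightarrow> z \<in> A"
  shows "inversion_image Q lam A = B"
proof (intro equalityI subsetI)
  fix w assume "w \<in> B"
  with assms(2) have w: "w \<noteq> Q" by blast
  have "inversion Q lam w \<in> A - {Q}"
    using assms(3)[OF inversion_neq_center[OF assms(1) w]] inversion_neq_center[OF assms(1) w]
      inversion_involutive[OF assms(1) w] \<open>w \<in> B\<close> by simp
  then show "w \<in> inversion_image Q lam A"
    unfolding inversion_image_def using inversion_involutive[OF assms(1) w] by (metis imageI)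
qed (use assms in \<open>auto simp: inversion_image_def\<close>)

lemma norm_diff_square: "(norm (x - y))\<^sup>2 = x \<bullet> x - 2 * (x \<bullet> y) + y \<bullet> y" for x y :: complex
  by (simp add: power2_norm_eq_inner inner_diff inner_commute)

lemma eq_abs_iff_square: "x = \<bar>y\<bar> \<longleftrightarrow> x\<^sup>2 = y\<^sup>2" if "x \<ge> 0" for x y :: real
  using that power2_eq_iff_nonneg[of x "\<bar>y\<bar>"] by simp

text \<open>The law of cosines in the triangle with vertices \<open>Q\<close>, \<open>c\<close>, \<open>c'\<close>, written with powers of
  \<open>Q\<close>. Tangency thus becomes a relation that is linear in the powers.\<close>

lemma inner_tangent:
  assumes "dist c c' = \<bar>r + r'\<bar>"
  shows "2 * ((c - Q) \<bullet> (c' - Q)) = circle_power Q c r + circle_power Q c' r' - 2 * r * r'"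
proof -
  have "(norm ((c - Q) - (c' - Q)))\<^sup>2 = (r + r')\<^sup>2"
    using assms by (simp add: dist_norm)
  then show ?thesis
    unfolding norm_diff_square
    by (simp add: circle_power_def dist_norm power2_norm_eq_inner power2_sum)
qed

text \<open>The proof shows that the power of \<open>inversion Q lam z\<close> with respect to the image circle is a
  nonzero multiple of the power of \<open>z\<close> with respect to the original circle, so that both vanish
  together. The point \<open>Q\<close> itself has the nonzero power \<open>lam ^ 4 / p\<close> with respect to the
  image, hence is not on it.\<close>

lemma inversion_image_sphere:
  assumes "lam > 0" "circle_power Q c r \<noteq> 0"
  shows "inversion_image Q lam (sphere c \<bar>r\<bar>) =
         sphere (inv_center Q lam c r) \<bar>inv_radius Q lam c r\<bar>"
proof (rule inversion_image_eqI[OF assms(1)])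
  let ?p = "circle_power Q c r"
  have on_sphere: "z \<in> sphere x \<bar>y\<bar> \<longleftrightarrow> (norm (z - x))\<^sup>2 = y\<^sup>2" for z x :: complex and y
    by (simp add: dist_norm norm_minus_commute[of x] eq_abs_iff_square)
  have p: "?p = (c - Q) \<bullet> (c - Q) - r\<^sup>2"
    by (simp add: circle_power_def dist_norm power2_norm_eq_inner)
  have "(norm (Q - inv_center Q lam c r))\<^sup>2 - (inv_radius Q lam c r)\<^sup>2 = (lam\<^sup>2)\<^sup>2 / ?p"
  proof -
    have "norm (Q - inv_center Q lam c r) = \<bar>lam\<^sup>2 / ?p\<bar> * norm (c - Q)"
      by (simp add: inv_center_def)
    then have "(norm (Q - inv_center Q lam c r))\<^sup>2 = (lam\<^sup>2 / ?p)\<^sup>2 * ((c - Q) \<bullet> (c - Q))"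
      by (simp only: power_mult_distrib power2_abs power2_norm_eq_inner)
    moreover have "inv_radius Q lam c r = lam\<^sup>2 / ?p * r" by (simp add: inv_radius_def)
    ultimately have "(norm (Q - inv_center Q lam c r))\<^sup>2 - (inv_radius Q lam c r)\<^sup>2
        = (lam\<^sup>2 / ?p)\<^sup>2 * ((c - Q) \<bullet> (c - Q) - r\<^sup>2)"
      by (simp only: power_mult_distrib right_diff_distrib)
    then show ?thesis using assms(2) unfolding p[symmetric]
      by (simp add: field_simps power2_eq_square)
  qed
  then show "Q \<notin> sphere (inv_center Q lam c r) \<bar>inv_radius Q lam c r\<bar>"
    unfolding on_sphere using assms by auto
  fix z assume "z \<noteq> Q"
  define w e q k where "w = z - Q" and "e = c - Q" and "q = w \<bullet> w" and "k = lam\<^sup>2"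
  have q: "q \<noteq> 0" "q > 0" and k: "k \<noteq> 0" using \<open>z \<noteq> Q\<close> assms(1) by (auto simp: q_def w_def k_def)
  define x y where "x = k / q" and "y = k / ?p"
  have diff: "inversion Q lam z - inv_center Q lam c r = x *\<^sub>R w - y *\<^sub>R e"
    by (simp add: inversion_def inv_center_def w_def e_def q_def k_def x_def y_def dist_norm
        power2_norm_eq_inner)
  have rad: "inv_radius Q lam c r = y * r" by (simp add: inv_radius_def y_def k_def)
  have "(norm (inversion Q lam z - inv_center Q lam c r))\<^sup>2 - (inv_radius Q lam c r)\<^sup>2
      = x\<^sup>2 * q - 2 * x * y * (w \<bullet> e) + y\<^sup>2 * (e \<bullet> e - r\<^sup>2)"
    unfolding diff rad norm_diff_square by (simp add: q_def power2_eq_square algebra_simps)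
  also have "\<dots> = k\<^sup>2 / (q * ?p) * (?p - 2 * (w \<bullet> e) + q)"
    unfolding p[folded e_def, symmetric] x_def y_def using q assms(2)
    by (simp add: field_simps power2_eq_square)
  also have "?p - 2 * (w \<bullet> e) + q = (norm (z - c))\<^sup>2 - r\<^sup>2"
  proof -
    have "z - c = w - e" by (simp add: w_def e_def)
    then show ?thesis by (simp add: norm_diff_square p e_def[symmetric] q_def)
  qed
  finally have "(norm (inversion Q lam z - inv_center Q lam c r))\<^sup>2 - (inv_radius Q lam c r)\<^sup>2
    = k\<^sup>2 / (q * ?p) * ((norm (z - c))\<^sup>2 - r\<^sup>2)" .
  moreover have "k\<^sup>2 / (q * ?p) \<noteq> 0" using q k assms(2) by simp
  ultimately show "inversion Q lam z \<in> sphere (inv_center Q lam c r) \<bar>inv_radius Q lam c r\<bar> \<longleftrightarrow>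
      z \<in> sphere c \<bar>r\<bar>"
    unfolding on_sphere by (metis eq_iff_diff_eq_0 mult_eq_0_iff)
qed

lemma inversion_image_sphere_circle:
  assumes "lam > 0" "circle_power Q c r \<noteq> 0" "r \<noteq> 0"
  shows "is_circle (inversion_image Q lam (sphere c \<bar>r\<bar>))"
    and "circle_center (inversion_image Q lam (sphere c \<bar>r\<bar>)) = inv_center Q lam c r"
proof -
  have "\<bar>inv_radius Q lam c r\<bar> > 0"
    using assms by (simp add: inv_radius_def)
  then show "is_circle (inversion_image Q lam (sphere c \<bar>r\<bar>))"
    and "circle_center (inversion_image Q lam (sphere c \<bar>r\<bar>)) = inv_center Q lam c r"
    unfolding inversion_image_sphere[OF assms(1,2)]
    unfolding is_circle_def by (blast, simp add: circle_center_sphere)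
qed

text \<open>Tangency in the signed sense is invariant under inversion. For a chain circle and a Soddy
  circle the left-hand side is the distance of a polygon vertex from a focus.\<close>

lemma dist_inv_center_tangent:
  assumes "dist c c' = \<bar>r + r'\<bar>" "circle_power Q c r \<noteq> 0" "circle_power Q c' r' \<noteq> 0"
  shows "dist (inv_center Q lam c r) (inv_center Q lam c' r') =
         \<bar>inv_radius Q lam c r + inv_radius Q lam c' r'\<bar>"
proof -
  define e e' p p' k where "e = c - Q" and "e' = c' - Q" and "p = circle_power Q c r"
    and "p' = circle_power Q c' r'" and "k = lam\<^sup>2"
  have p: "e \<bullet> e = p + r\<^sup>2" "e' \<bullet> e' = p' + r'\<^sup>2"
    by (simp_all add: e_def e'_def p_def p'_def circle_power_def dist_norm power2_norm_eq_inner)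
  have ee: "2 * (e \<bullet> e') = p + p' - 2 * r * r'"
    unfolding e_def e'_def p_def p'_def by (rule inner_tangent[OF assms(1)])
  have "(dist (inv_center Q lam c r) (inv_center Q lam c' r'))\<^sup>2
      = (norm ((k / p) *\<^sub>R e - (k / p') *\<^sub>R e'))\<^sup>2"
    by (simp add: dist_norm inv_center_def e_def e'_def p_def p'_def k_def)
  also have "\<dots> = (k / p)\<^sup>2 * (e \<bullet> e) - (k / p) * (k / p') * (2 * (e \<bullet> e')) + (k / p')\<^sup>2 * (e' \<bullet> e')"
    unfolding norm_diff_square by (simp add: power2_eq_square mult_ac)
  also have "\<dots> = (k * r / p + k * r' / p')\<^sup>2"
    unfolding ee p using assms(2,3)[folded p_def p'_def]
    by (simp add: field_simps power2_eq_square)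
  finally have "dist (inv_center Q lam c r) (inv_center Q lam c' r') = \<bar>k * r / p + k * r' / p'\<bar>"
    by (subst eq_abs_iff_square) auto
  then show ?thesis by (simp add: inv_radius_def p_def p'_def k_def)
qed

text \<open>This is Stewart's theorem for the point of tangency, which divides the line through the
  centers in the ratio of the signed radii. The left-hand side is, up to the factor
  \<open>lam ^ 2\<close> divided by the two powers, the sum of the signed radii after inversion, so the sign of that sum can be
  read off from the signs of the powers.\<close>

lemma circle_power_tangent:
  assumes "dist c c' = \<bar>r + r'\<bar>" "r + r' \<noteq> 0"
  shows "r * circle_power Q c' r' + r' * circle_power Q c r =
         (r + r') * (dist Q ((1 / (r + r')) *\<^sub>R (r *\<^sub>R c' + r' *\<^sub>R c)))\<^sup>2"
proof -
  define e e' p p' where "e = c - Q" and "e' = c' - Q" and "p = circle_power Q c r"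
    and "p' = circle_power Q c' r'"
  have p: "e \<bullet> e = p + r\<^sup>2" "e' \<bullet> e' = p' + r'\<^sup>2"
    by (simp_all add: e_def e'_def p_def p'_def circle_power_def dist_norm power2_norm_eq_inner)
  have ee: "2 * (e \<bullet> e') = p + p' - 2 * r * r'"
    unfolding e_def e'_def p_def p'_def by (rule inner_tangent[OF assms(1)])
  have "(1 / (r + r')) *\<^sub>R (r *\<^sub>R c' + r' *\<^sub>R c) - Q
      = (1 / (r + r')) *\<^sub>R (r *\<^sub>R c' + r' *\<^sub>R c - (r + r') *\<^sub>R Q)"
    using assms(2) by (simp add: scaleR_diff_right)
  also have "r *\<^sub>R c' + r' *\<^sub>R c - (r + r') *\<^sub>R Q = r *\<^sub>R e' + r' *\<^sub>R e"
    by (simp add: e_def e'_def algebra_simps)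
  finally have "(dist Q ((1 / (r + r')) *\<^sub>R (r *\<^sub>R c' + r' *\<^sub>R c)))\<^sup>2
      = (1 / (r + r'))\<^sup>2 * (norm (r *\<^sub>R e' + r' *\<^sub>R e))\<^sup>2"
    by (subst dist_commute) (simp add: dist_norm power_divide del: scaleR_add_right)
  also have "(norm (r *\<^sub>R e' + r' *\<^sub>R e))\<^sup>2
      = r\<^sup>2 * (e' \<bullet> e') + r * r' * (2 * (e \<bullet> e')) + r'\<^sup>2 * (e \<bullet> e)"
    unfolding power2_norm_eq_inner
    by (simp add: inner_add inner_commute power2_eq_square algebra_simps)
  also have "\<dots> = (r + r') * (r * p' + r' * p)"
    unfolding ee p by (simp add: power2_eq_square algebra_simps)
  finally show ?thesis using assms(2)
    by (simp add: p_def p'_def power2_eq_square)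
qed

section \<open>Lines and circles through the inversion center\<close>

lemma is_line_level_set:
  fixes n :: complex
  assumes "n \<noteq> 0"
  shows "is_line {w. n \<bullet> w = m}"
proof -
  define p where "p = (m / (n \<bullet> n)) *\<^sub>R n"
  have p: "n \<bullet> p = m" using assms by (simp add: p_def)
  have perp: "n \<bullet> (\<i> * n) = 0" by (simp add: inner_complex_def)
  have "{w. n \<bullet> w = m} = range (\<lambda>u. p + u *\<^sub>R (\<i> * n))"
  proof (intro equalityI subsetI)
    fix w assume "w \<in> {w. n \<bullet> w = m}"
    then have "n \<bullet> (w - p) = 0" by (simp add: inner_diff_right p)
    moreover obtain z where zn: "w - p = z * n"
      using assms by (metis nonzero_eq_divide_eq)
    moreover have "n \<bullet> (z * n) = Re z * (n \<bullet> n)"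
      by (simp add: inner_complex_def algebra_simps)
    ultimately have "Re z = 0" using assms by (metis inner_eq_zero_iff mult_eq_0_iff)
    then have "z = Im z *\<^sub>R \<i>" by (simp add: complex_eq_iff)
    then have "w = p + Im z *\<^sub>R (\<i> * n)"
      using zn by (metis add.commute diff_add_cancel mult_scaleR_left)
    then show "w \<in> range (\<lambda>u. p + u *\<^sub>R (\<i> * n))" by blast
  qed (auto simp: inner_add_right p perp)
  then have "{w. n \<bullet> w = m} = affine hull {p, p + \<i> * n}"
    by (simp add: affine_hull_2_alt)
  then show ?thesis using assms unfolding is_line_def
    by (intro exI[of _ p] exI[of _ "p + \<i> * n"]) simp
qed

lemma infdist_level_set:
  fixes n :: "'a::euclidean_space"
  assumes "n \<noteq> 0"
  shows "infdist w {x. n \<bullet> x = m} = \<bar>n \<bullet> w - m\<bar> / norm n"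
proof -
  define f where "f = w - ((n \<bullet> w - m) / (n \<bullet> n)) *\<^sub>R n"
  have f: "f \<in> {x. n \<bullet> x = m}" using assms by (simp add: f_def inner_diff_right)
  have df: "dist w f = \<bar>n \<bullet> w - m\<bar> / norm n"
    using assms by (simp add: f_def dist_norm flip: power2_norm_eq_inner) (simp add: power2_eq_square)
  have "\<bar>n \<bullet> w - m\<bar> / norm n \<le> dist w x" if "n \<bullet> x = m" for x
    using Cauchy_Schwarz_ineq2[of n "w - x"] assms that
    by (simp add: dist_norm inner_diff_right divide_simps mult.commute)
  then have "setdist {w} {x. n \<bullet> x = m} = dist w f"
    using f df by (intro setdist_unique) auto
  then show ?thesis by (simp add: infdist_eq_setdist df)
qed

lemma inversion_image_sphere_through_center:
  assumes "lam > 0" "c \<noteq> Q"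
  shows "inversion_image Q lam (sphere c (dist c Q)) = {w. (c - Q) \<bullet> w = (c - Q) \<bullet> Q + lam\<^sup>2 / 2}"
proof (rule inversion_image_eqI[OF assms(1)])
  show "Q \<notin> {w. (c - Q) \<bullet> w = (c - Q) \<bullet> Q + lam\<^sup>2 / 2}" using assms(1) by simp
  fix z assume "z \<noteq> Q"
  define e w where "e = c - Q" and "w = z - Q"
  have w: "w \<bullet> w > 0" using \<open>z \<noteq> Q\<close> by (simp add: w_def)
  have "inversion Q lam z = Q + (lam\<^sup>2 / (w \<bullet> w)) *\<^sub>R w"
    by (simp add: inversion_def w_def dist_norm power2_norm_eq_inner)
  then have "e \<bullet> inversion Q lam z = e \<bullet> Q + lam\<^sup>2 / 2 \<longleftrightarrow> 2 * (e \<bullet> w) = w \<bullet> w"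
    using w assms(1) by (simp add: inner_add_right field_simps)
  also have "\<dots> \<longleftrightarrow> (norm (e - w))\<^sup>2 = (norm e)\<^sup>2"
    unfolding norm_diff_square by (auto simp: power2_norm_eq_inner)
  also have "\<dots> \<longleftrightarrow> z \<in> sphere c (dist c Q)"
    by (simp add: e_def w_def dist_norm)
  finally show "inversion Q lam z \<in> {w. (c - Q) \<bullet> w = (c - Q) \<bullet> Q + lam\<^sup>2 / 2} \<longleftrightarrow>
      z \<in> sphere c (dist c Q)"
    by (simp add: e_def)
qed

text \<open>For \<open>t \<noteq> 0\<close> the circle with center \<open>c'\<close> and signed radius \<open>t\<close> passes through \<open>Q\<close> and becomes
  the line of all \<open>w\<close> with \<open>(c' - Q) \<bullet> w = (c' - Q) \<bullet> Q + lam ^ 2 / 2\<close>. As \<open>norm (c' - Q) = \<bar>t\<bar>\<close>,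
  the term with \<open>inv_radius\<close> says that the other circle is tangent to this line after inversion, and
  it records on which side.\<close>

lemma inner_inv_center_tangent:
  assumes "dist c c' = \<bar>r + t\<bar>" "circle_power Q c r \<noteq> 0" "circle_power Q c' t = 0"
  shows "(c' - Q) \<bullet> (inv_center Q lam c r) = (c' - Q) \<bullet> Q + lam\<^sup>2 / 2 - t * inv_radius Q lam c r"
proof -
  let ?p = "circle_power Q c r"
  have "(c' - Q) \<bullet> (c - Q) = ?p / 2 - r * t"
    using inner_tangent[OF assms(1), of Q] assms(3) by (simp add: inner_commute)
  then have "(c' - Q) \<bullet> inv_center Q lam c r = (c' - Q) \<bullet> Q + lam\<^sup>2 / ?p * (?p / 2 - r * t)"
    by (simp only: inv_center_def inner_add_right inner_scaleR_right)
  then show ?thesis using assms(2) by (simp add: inv_radius_def field_simps)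
qed

section \<open>The conic through the centers\<close>

text \<open>The directrix \<open>L\<close> is the image line moved by the signed radius of the image of the other
  circle. Both the distance to \<open>L\<close> and the distance to the focus then become the absolute value of
  the sum of the same two signed radii. As \<open>c\<close> and \<open>r\<close> are quantified inside, one conic serves
  all circles tangent to the two given ones.\<close>

lemma parabola_of_centers:
  assumes "lam > 0" "dist x0 Q = \<bar>t\<bar>" "t \<noteq> 0" "t' \<noteq> 0" "t\<^sup>2 \<noteq> t'\<^sup>2"
  shows "\<exists>L E. parallel_lines (inversion_image Q lam (sphere x0 \<bar>t\<bar>)) L \<and>
    is_parabola (inv_center Q lam x0 t') L E \<and>
    (\<forall>c r. dist c x0 = \<bar>r + t\<bar> \<and> dist c x0 = \<bar>r + t'\<bar> \<and> circle_power Q c r \<noteq> 0 \<longrightarrow>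
           inv_center Q lam c r \<in> E)"
proof -
  define n F k where "n = x0 - Q" and "F = inv_center Q lam x0 t'"
    and "k = t * inv_radius Q lam x0 t'"
  define L where "L = {w. n \<bullet> w = n \<bullet> Q + lam\<^sup>2 / 2 + k}"
  have n: "n \<noteq> 0" "norm n = \<bar>t\<bar>" "n \<bullet> n = t\<^sup>2"
    using assms(2,3) by (auto simp: n_def dist_norm simp flip: power2_norm_eq_inner)
  have p: "circle_power Q x0 t = 0" "circle_power Q x0 t' = t\<^sup>2 - t'\<^sup>2" "t\<^sup>2 - t'\<^sup>2 \<noteq> 0"
    using assms(2,5) by (simp_all add: circle_power_def)
  have S: "inversion_image Q lam (sphere x0 \<bar>t\<bar>) = {w. n \<bullet> w = n \<bullet> Q + lam\<^sup>2 / 2}"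
    using inversion_image_sphere_through_center[OF assms(1), of x0 Q] n(1)
    by (simp add: n_def assms(2))
  have "k \<noteq> 0" using assms p by (simp add: k_def inv_radius_def)
  then have "parallel_lines (inversion_image Q lam (sphere x0 \<bar>t\<bar>)) L"
    unfolding parallel_lines_def S L_def using is_line_level_set[OF n(1)] by auto
  moreover have "is_parabola F L {z. dist z F = infdist z L}"
  proof -
    define D where "D = t\<^sup>2 - t'\<^sup>2"
    have D: "D \<noteq> 0" using p(3) by (simp add: D_def)
    have "n \<bullet> F - (n \<bullet> Q + lam\<^sup>2 / 2 + k) = lam\<^sup>2 / D * t\<^sup>2 - lam\<^sup>2 / 2 - t * (lam\<^sup>2 * t' / D)"
      unfolding F_def inv_center_def k_def inv_radius_def p(2) n_def[symmetric] D_def[symmetric]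
      by (simp add: inner_add_right n(3))
    also have "\<dots> = lam\<^sup>2 * (2 * t\<^sup>2 - D - 2 * t * t') / (2 * D)"
      using D by (simp add: field_simps power2_eq_square)
    also have "2 * t\<^sup>2 - D - 2 * t * t' = (t - t')\<^sup>2"
      by (simp add: D_def power2_eq_square algebra_simps)
    also have "lam\<^sup>2 * (t - t')\<^sup>2 / (2 * D) \<noteq> 0" using assms by (auto simp: D_def)
    finally have "F \<notin> L" by (simp add: L_def)
    then show ?thesis unfolding is_parabola_def L_def using is_line_level_set[OF n(1)] by blast
  qed
  moreover have "inv_center Q lam c r \<in> {z. dist z F = infdist z L}"
    if c: "dist c x0 = \<bar>r + t\<bar>" "dist c x0 = \<bar>r + t'\<bar>" "circle_power Q c r \<noteq> 0" for c r
  proof -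
    let ?\<rho> = "inv_radius Q lam c r" and ?\<rho>' = "inv_radius Q lam x0 t'"
    have "n \<bullet> inv_center Q lam c r - (n \<bullet> Q + lam\<^sup>2 / 2 + k) = - t * (?\<rho> + ?\<rho>')"
      unfolding inner_inv_center_tangent[OF c(1,3) p(1), of lam, folded n_def] k_def
      by (simp add: algebra_simps)
    then have "infdist (inv_center Q lam c r) L = \<bar>- t * (?\<rho> + ?\<rho>')\<bar> / norm n"
      unfolding L_def infdist_level_set[OF n(1)] by (simp only:)
    also have "\<dots> = \<bar>?\<rho> + ?\<rho>'\<bar>" using assms(3) by (simp add: n(2) abs_mult)
    also have "\<dots> = dist (inv_center Q lam c r) F"
      unfolding F_def using dist_inv_center_tangent[OF c(2,3), of lam] p by simp
    finally show ?thesis by simp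
  qed
  ultimately show ?thesis unfolding F_def by blast
qed

text \<open>The left-hand side compares the length of a conic's focal axis, which will be the absolute difference of
  the two signed radii, with the distance of its foci, the two image centers. Its sign, which is the
  sign of the product of the powers, tells an ellipse from a hyperbola.\<close>

lemma inv_radius_diff_sq_concentric:
  assumes "circle_power Q x0 t \<noteq> 0" "circle_power Q x0 t' \<noteq> 0"
  shows "(inv_radius Q lam x0 t - inv_radius Q lam x0 t')\<^sup>2
       - (dist (inv_center Q lam x0 t) (inv_center Q lam x0 t'))\<^sup>2
       = (lam\<^sup>2 * (t - t'))\<^sup>2 / (circle_power Q x0 t * circle_power Q x0 t')"
proof -
  define k p p' d where "k = lam\<^sup>2" and "p = circle_power Q x0 t" and "p' = circle_power Q x0 t'"
    and "d = (dist x0 Q)\<^sup>2"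
  have pp: "p \<noteq> 0" "p' \<noteq> 0" using assms by (simp_all add: p_def p'_def)
  have d: "d = p + t\<^sup>2" "p' = p + t\<^sup>2 - t'\<^sup>2" by (simp_all add: p_def p'_def d_def circle_power_def)
  have "inv_center Q lam x0 t - inv_center Q lam x0 t' = (k / p - k / p') *\<^sub>R (x0 - Q)"
    by (simp add: inv_center_def p_def p'_def k_def algebra_simps)
  then have D: "(dist (inv_center Q lam x0 t) (inv_center Q lam x0 t'))\<^sup>2 = (k / p - k / p')\<^sup>2 * d"
    by (simp add: dist_norm d_def power_mult_distrib)
  have "(k * t / p - k * t' / p')\<^sup>2 - (k / p - k / p')\<^sup>2 * d
      = k\<^sup>2 * ((t * p' - t' * p)\<^sup>2 - (p' - p)\<^sup>2 * d) / (p * p')\<^sup>2"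
    using pp by (simp add: field_simps power2_eq_square)
  also have "(t * p' - t' * p)\<^sup>2 - (p' - p)\<^sup>2 * d = (t - t')\<^sup>2 * (p * p')"
    unfolding d by (simp add: power2_eq_square algebra_simps)
  also have "k\<^sup>2 * ((t - t')\<^sup>2 * (p * p')) / (p * p')\<^sup>2 = (k * (t - t'))\<^sup>2 / (p * p')"
    using pp by (simp add: field_simps power2_eq_square)
  finally show ?thesis
    unfolding D by (simp add: inv_radius_def k_def p_def p'_def)
qed

text \<open>For \<open>r > 0\<close> the negative factor of \<open>(r + t) * (r + t')\<close> belongs to a circle that encloses the
  circle around \<open>c\<close>, as the outer Soddy circle does, and the positive factor to one that does not,
  such as the inner Soddy circle. By \<open>circle_power_tangent\<close> each of \<open>x\<close> and \<open>y\<close> is the corresponding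
  factor times a square, divided by two powers; one of these, the power for \<open>c\<close>, occurs in both and
  cancels from the sign of \<open>x * y\<close>.\<close>

lemma inv_radius_sum_sign:
  fixes lam :: real
  assumes "dist c c1 = \<bar>r + t\<bar>" "dist c c2 = \<bar>r + t'\<bar>" "(r + t) * (r + t') < 0"
    "circle_power Q c r \<noteq> 0" "circle_power Q c1 t \<noteq> 0" "circle_power Q c2 t' \<noteq> 0"
  defines "x \<equiv> inv_radius Q lam c r + inv_radius Q lam c1 t"
    and "y \<equiv> inv_radius Q lam c r + inv_radius Q lam c2 t'"
  shows "circle_power Q c1 t * circle_power Q c2 t' * (x * y) \<le> 0"
proof -
  define k D p p' where "k = lam\<^sup>2" and "D = circle_power Q c r" and "p = circle_power Q c1 t"
    and "p' = circle_power Q c2 t'"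
  have nz: "D \<noteq> 0" "p \<noteq> 0" "p' \<noteq> 0" using assms by (simp_all add: D_def p_def p'_def)
  have rt: "r + t \<noteq> 0" "r + t' \<noteq> 0" using assms(3) by auto
  obtain q where q: "q \<ge> 0" "r * p + t * D = (r + t) * q"
    using circle_power_tangent[OF assms(1) rt(1), of Q] unfolding D_def p_def
    by (metis zero_le_power2)
  obtain q' where q': "q' \<ge> 0" "r * p' + t' * D = (r + t') * q'"
    using circle_power_tangent[OF assms(2) rt(2), of Q] unfolding D_def p'_def
    by (metis zero_le_power2)
  have "x = k * (r * p + t * D) / (D * p)" "y = k * (r * p' + t' * D) / (D * p')"
    using nz unfolding x_def y_def inv_radius_def k_def[symmetric] D_def[symmetric] p_def[symmetric]
      p'_def[symmetric] by (simp_all add: field_simps)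
  then have "p * p' * (x * y) = p * p' * ((k * ((r + t) * q) / (D * p)) * (k * ((r + t') * q') / (D * p')))"
    by (simp only: q(2) q'(2))
  also have "\<dots> = ((r + t) * (r + t')) * ((k / D)\<^sup>2 * (q * q'))"
    using nz by (simp add: power2_eq_square)
  also have "\<dots> \<le> 0"
    by (rule mult_nonpos_nonneg[OF less_imp_le[OF assms(3)]]) (simp add: q(1) q'(1))
  finally show ?thesis by (simp add: p_def p'_def)
qed

text \<open>Since \<open>x - y\<close> is the same for all circles tangent to both given ones, the sign of \<open>x * y\<close>
  decides whether \<open>\<bar>x\<bar> + \<bar>y\<bar>\<close> or \<open>\<bar>\<bar>x\<bar> - \<bar>y\<bar>\<bar>\<close> is constant. The hypothesis \<open>not_limit\<close> excludes the
  two image circles having equal signed radii, in which case the centers would lie on the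
  perpendicular bisector of the foci instead of on a hyperbola.\<close>

lemma central_conic_of_centers:
  assumes "lam > 0" "t \<noteq> t'"
    and "circle_power Q x0 t \<noteq> 0" "circle_power Q x0 t' \<noteq> 0"
    and not_limit: "(dist x0 Q)\<^sup>2 + t * t' \<noteq> 0"
  defines "F \<equiv> inv_center Q lam x0 t" and "F' \<equiv> inv_center Q lam x0 t'"
  shows "\<exists>E. (circle_power Q x0 t * circle_power Q x0 t' > 0 \<longrightarrow> is_ellipse F F' E) \<and>
    (circle_power Q x0 t * circle_power Q x0 t' < 0 \<longrightarrow> is_hyperbola F F' E) \<and>
    (\<forall>c r. dist c x0 = \<bar>r + t\<bar> \<and> dist c x0 = \<bar>r + t'\<bar> \<and> circle_power Q c r \<noteq> 0 \<longrightarrow>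
           inv_center Q lam c r \<in> E)"
proof -
  let ?p = "circle_power Q x0 t" and ?p' = "circle_power Q x0 t'"
  let ?\<sigma> = "inv_radius Q lam x0 t" and ?\<sigma>' = "inv_radius Q lam x0 t'"
  define A where "A = \<bar>?\<sigma> - ?\<sigma>'\<bar>"
  have A2: "A\<^sup>2 - (dist F F')\<^sup>2 = (lam\<^sup>2 * (t - t'))\<^sup>2 / (?p * ?p')"
    using inv_radius_diff_sq_concentric[OF assms(3,4), of lam] by (simp add: A_def F_def F'_def)
  have num: "(lam\<^sup>2 * (t - t'))\<^sup>2 > 0" using assms(1,2) by simp
  have vertex: "dist (inv_center Q lam c r) F = \<bar>x\<bar> \<and> dist (inv_center Q lam c r) F' = \<bar>y\<bar> \<and>
      A = \<bar>x - y\<bar> \<and> ?p * ?p' * (x * y) \<le> 0"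
    if c: "dist c x0 = \<bar>r + t\<bar>" "dist c x0 = \<bar>r + t'\<bar>" "circle_power Q c r \<noteq> 0"
      and xy: "x = inv_radius Q lam c r + ?\<sigma>" "y = inv_radius Q lam c r + ?\<sigma>'" for c r x y
  proof -
    \<comment> \<open>The same distance from \<open>x0\<close> belongs to both tangencies, and \<open>t \<noteq> t'\<close> rules out equal signs.\<close>
    have "r + t' = - (r + t)" and rt: "r + t \<noteq> 0" using c(1,2) assms(2) by linarith+
    then have "(r + t) * (r + t') = - ((r + t)\<^sup>2)"
      by (simp only: power2_eq_square mult_minus_right)
    then have opp: "(r + t) * (r + t') < 0" using rt by simp
    then show ?thesis
      using dist_inv_center_tangent[OF c(1,3) assms(3), of lam]
        dist_inv_center_tangent[OF c(2,3) assms(4), of lam]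
        inv_radius_sum_sign[OF c(1,2) opp c(3) assms(3,4), of lam]
      by (simp add: F_def F'_def A_def xy)
  qed
  show ?thesis
  proof (cases "?p * ?p' > 0")
    case True
    have "A\<^sup>2 > (dist F F')\<^sup>2" using A2 num True by (smt (verit) divide_pos_pos)
    then have "dist F F' < A" by (rule power2_less_imp_less) (simp add: A_def)
    then have "is_ellipse F F' {z. dist z F + dist z F' = A}"
      unfolding is_ellipse_def by (intro exI[of _ "A / 2"]) simp
    moreover have "\<bar>x\<bar> + \<bar>y\<bar> = \<bar>x - y\<bar>" if "?p * ?p' * (x * y) \<le> 0" for x y
    proof -
      have "x * y \<le> 0" using that True by (metis mult_pos_pos not_less)
      then show ?thesis by (auto simp: mult_le_0_iff)
    qed
    ultimately show ?thesis using True vertex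
      by (intro exI[of _ "{z. dist z F + dist z F' = A}"]) auto
  next
    case False
    then have neg: "?p * ?p' < 0" using assms(3,4) by (simp add: less_le not_less)
    have "A\<^sup>2 < (dist F F')\<^sup>2" using A2 num neg by (smt (verit) divide_pos_neg)
    then have "A < dist F F'" by (rule power2_less_imp_less) simp
    moreover have "A > 0"
    proof -
      have "?\<sigma> - ?\<sigma>' = lam\<^sup>2 * (t * ?p' - t' * ?p) / (?p * ?p')"
        using assms(3,4) by (simp add: inv_radius_def field_simps)
      also have "t * ?p' - t' * ?p = (t - t') * ((dist x0 Q)\<^sup>2 + t * t')"
        by (simp add: circle_power_def power2_eq_square algebra_simps)
      finally show ?thesis using assms by (simp add: A_def)
    qed
    ultimately have "is_hyperbola F F' {z. \<bar>dist z F - dist z F'\<bar> = A}"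
      unfolding is_hyperbola_def by (intro exI[of _ "A / 2"]) simp
    moreover have "\<bar>\<bar>x\<bar> - \<bar>y\<bar>\<bar> = \<bar>x - y\<bar>" if "?p * ?p' * (x * y) \<le> 0" for x y
    proof -
      have "x * y \<ge> 0" using that neg by (metis mult_neg_neg not_less)
      then show ?thesis by (auto simp: zero_le_mult_iff)
    qed
    ultimately show ?thesis using False vertex
      by (intro exI[of _ "{z. \<bar>dist z F - dist z F'\<bar> = A}"]) auto
  qed
qed

section \<open>Steiner-Soddy polygons\<close>

lemma inscribed_in_of_centers:
  assumes "lam > 0" "R > 0" "R * sin (pi / real N) > 0" "admissible N R Q \<phi>"
    and "\<And>c. dist c 0 = R \<Longrightarrow> circle_power Q c (R * sin (pi / real N)) \<noteq> 0 \<Longrightarrow>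
           inv_center Q lam c (R * sin (pi / real N)) \<in> E"
  shows "inscribed_in (steiner_soddy_polygon N R Q lam \<phi>) E"
  unfolding inscribed_in_def
proof
  let ?s = "R * sin (pi / real N)"
  fix v assume "v \<in> set (steiner_soddy_polygon N R Q lam \<phi>)"
  then obtain i where i: "i \<in> {1..N}" "v = circle_center (steiner_circle N R Q lam \<phi> i)"
    unfolding steiner_soddy_polygon_def set_map set_upt by fastforce
  define c where "c = rcis R (\<phi> + 2 * pi * real i / real N)"
  have "Q \<notin> sphere c ?s"
    using assms(4) i(1) by (auto simp: admissible_def reg_circle_def c_def)
  then have p: "circle_power Q c ?s \<noteq> 0"
    using assms(3) by (simp add: circle_power_def power2_eq_iff_nonneg)
  have "v = inv_center Q lam c ?s"
    using inversion_image_sphere_circle(2)[OF assms(1) p] assms(3)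
    by (simp only: i(2) steiner_circle_def reg_circle_def c_def[symmetric] abs_of_pos)
  moreover have "dist c 0 = R" using assms(2) by (simp add: c_def)
  ultimately show "v \<in> E" using assms(5) p by simp
qed

theorem proposition1:
  fixes N :: nat and R lam :: real and Q :: complex
  assumes "N \<ge> 3" and "R > 0" and "lam > 0" and "Q \<notin> C_reg N R"
  defines "S \<equiv> soddy N R Q lam" and "S' \<equiv> soddy' N R Q lam"
  shows "\<exists>E.
    (\<forall>\<phi>. admissible N R Q \<phi> \<longrightarrow> inscribed_in (steiner_soddy_polygon N R Q lam \<phi>) E) \<and>
    (Q \<in> ball 0 (inner_radius N R) \<or> Q \<notin> cball 0 (outer_radius N R) \<longrightarrow>
       is_circle S \<and> is_circle S' \<and> is_ellipse (circle_center S) (circle_center S') E) \<and>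
    (Q \<in> ball 0 (outer_radius N R) - cball 0 (inner_radius N R) \<longrightarrow>
       is_circle S \<and> is_circle S' \<and> is_hyperbola (circle_center S) (circle_center S') E) \<and>
    (Q \<in> S_reg N R \<union> S_reg' N R \<longrightarrow>
       (\<exists>L. is_circle S \<and> parallel_lines S' L \<and> is_parabola (circle_center S) L E \<or>
            is_circle S' \<and> parallel_lines S L \<and> is_parabola (circle_center S') L E))"
proof -
  define s a b d where "s = R * sin (pi / real N)" and "a = inner_radius N R"
    and "b = outer_radius N R" and "d = norm Q"
  have ang: "0 < pi / real N" "pi / real N < pi / 2" using assms(1) by (auto simp: field_simps)
  then have sin: "0 < sin (pi / real N)" "sin (pi / real N) < 1"
    using sin_gt_zero_02[of "pi / real N"] sin_monotone_2pi[of "pi / real N" "pi / 2"] pi_less_4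
    by (auto intro!: sin_gt_zero)
  have s: "s > 0" "a = R - s" "b = R + s" using assms(2) sin
    by (simp_all add: s_def a_def b_def inner_radius_def outer_radius_def algebra_simps)
  have a: "a > 0" using assms(2) sin by (simp add: a_def inner_radius_def)
  have ab: "a < b" "\<bar>a\<bar> = a" "\<bar>- b\<bar> = b" using a s by simp_all
  have d0: "d \<ge> 0" by (simp add: d_def)
  have tangent: "dist c 0 = \<bar>s + a\<bar>" "dist c 0 = \<bar>s + - b\<bar>" if "dist c 0 = R" for c :: complex
    using that assms(2) by (simp_all add: s)
  have inscribed: "\<forall>\<phi>. admissible N R Q \<phi> \<longrightarrow> inscribed_in (steiner_soddy_polygon N R Q lam \<phi>) E"
    if "\<And>c. dist c 0 = R \<Longrightarrow> circle_power Q c s \<noteq> 0 \<Longrightarrow> inv_center Q lam c s \<in> E" for E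
    using inscribed_in_of_centers[OF assms(3,2) s(1)[unfolded s_def]] that unfolding s_def by blast
  have power: "circle_power Q 0 t = d\<^sup>2 - t\<^sup>2" for t by (simp add: circle_power_def d_def)
  have sphere: "S = inversion_image Q lam (sphere 0 \<bar>a\<bar>)" "S' = inversion_image Q lam (sphere 0 \<bar>- b\<bar>)"
    unfolding ab(2,3)
    by (simp_all add: S_def S'_def soddy_def soddy'_def S_reg_def S_reg'_def a_def b_def)
  have S: "is_circle S" "circle_center S = inv_center Q lam 0 a" if "d \<noteq> a"
    using inversion_image_sphere_circle[OF assms(3), of Q 0 a] that a d0
    by (simp_all add: sphere power power2_eq_iff_nonneg)
  have S': "is_circle S'" "circle_center S' = inv_center Q lam 0 (- b)" if "d \<noteq> b"
    using inversion_image_sphere_circle[OF assms(3), of Q 0 "- b"] that a d0 ab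
    by (simp_all add: sphere power power2_eq_iff_nonneg)
  have region: "Q \<in> ball 0 a \<longleftrightarrow> d < a" "Q \<notin> cball 0 b \<longleftrightarrow> d > b"
    "Q \<in> ball 0 b - cball 0 a \<longleftrightarrow> a < d \<and> d < b"
    "Q \<in> S_reg N R \<union> S_reg' N R \<longleftrightarrow> d = a \<or> d = b"
    by (auto simp: d_def S_reg_def S_reg'_def a_def b_def)
  have sq: "a\<^sup>2 \<noteq> b\<^sup>2" using ab a by (simp add: power2_eq_iff_nonneg)
  \<comment> \<open>On the circle of contact points the two Soddy circles would get equal signed radii.\<close>
  have "a * b = (R * cos (pi / real N))\<^sup>2"
    by (simp add: s s_def power_mult_distrib cos_squared_eq) (simp add: power2_eq_square algebra_simps)
  moreover have "R * cos (pi / real N) > 0" using assms(2) ang by (simp add: cos_gt_zero)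
  moreover have "d \<noteq> R * cos (pi / real N)" using assms(4) by (simp add: d_def C_reg_def)
  ultimately have not_limit: "d\<^sup>2 \<noteq> a * b" using d0 by (simp add: power2_eq_iff_nonneg)
  have "\<exists>E.
    (\<forall>c r. dist c 0 = \<bar>r + a\<bar> \<and> dist c 0 = \<bar>r + - b\<bar> \<and> circle_power Q c r \<noteq> 0 \<longrightarrow>
           inv_center Q lam c r \<in> E) \<and>
    (d < a \<or> d > b \<longrightarrow>
       is_circle S \<and> is_circle S' \<and> is_ellipse (circle_center S) (circle_center S') E) \<and>
    (a < d \<and> d < b \<longrightarrow>
       is_circle S \<and> is_circle S' \<and> is_hyperbola (circle_center S) (circle_center S') E) \<and>
    (d = a \<or> d = b \<longrightarrow>
       (\<exists>L. is_circle S \<and> parallel_lines S' L \<and> is_parabola (circle_center S) L E \<or>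
            is_circle S' \<and> parallel_lines S L \<and> is_parabola (circle_center S') L E))"
    (is "\<exists>E. ?vertices E \<and> ?conic E")
  proof -
    consider "d = a" | "d = b" | "d \<noteq> a" "d \<noteq> b" by blast
    then show ?thesis
    proof cases
      case 1
      obtain L E where "parallel_lines S L" "is_parabola (inv_center Q lam 0 (- b)) L E" "?vertices E"
        using parabola_of_centers[of lam 0 Q a "- b"] assms(3) a ab sq 1
        unfolding sphere by (auto simp: d_def)
      then show ?thesis using S' ab 1 by (intro exI[of _ E]) auto
    next
      case 2
      obtain L E where "parallel_lines S' L" "is_parabola (inv_center Q lam 0 a) L E" "?vertices E"
        using parabola_of_centers[of lam 0 Q "- b" a] assms(3) a ab sq 2
        unfolding sphere by (auto simp: d_def)
      then show ?thesis using S ab 2 by (intro exI[of _ E]) auto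
    next
      case 3
      have nz: "circle_power Q 0 a \<noteq> 0" "circle_power Q 0 (- b) \<noteq> 0"
        using 3 a ab d0 by (simp_all add: power power2_eq_iff_nonneg)
      have mono: "x\<^sup>2 < y\<^sup>2 \<longleftrightarrow> x < y" if "x \<ge> 0" "y \<ge> 0" for x y :: real
        using that by (metis power2_less_imp_less power_strict_mono zero_less_numeral)
      have signs: "d < a \<or> d > b \<Longrightarrow> circle_power Q 0 a * circle_power Q 0 (- b) > 0"
        "a < d \<and> d < b \<Longrightarrow> circle_power Q 0 a * circle_power Q 0 (- b) < 0"
        using a ab d0 by (auto simp: power mono zero_less_mult_iff mult_less_0_iff)
      obtain E where "?vertices E"
        "circle_power Q 0 a * circle_power Q 0 (- b) > 0 \<longrightarrow>
           is_ellipse (inv_center Q lam 0 a) (inv_center Q lam 0 (- b)) E"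
        "circle_power Q 0 a * circle_power Q 0 (- b) < 0 \<longrightarrow>
           is_hyperbola (inv_center Q lam 0 a) (inv_center Q lam 0 (- b)) E"
        using central_conic_of_centers[OF assms(3) _ nz] not_limit a ab by (auto simp: d_def)
      then show ?thesis using S S' 3 signs by (intro exI[of _ E]) simp
    qed
  qed
  then obtain E where E: "?vertices E" "?conic E" by blast
  have "\<forall>\<phi>. admissible N R Q \<phi> \<longrightarrow> inscribed_in (steiner_soddy_polygon N R Q lam \<phi>) E"
    using E(1) tangent by (intro inscribed) blast
  then show ?thesis
    unfolding a_def[symmetric] b_def[symmetric] region using E(2) by blast
qed

end
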